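(* For every $p\in\omega^{*}$, the relation $\omega^{*}\rightarrow(\omega\cup\{p\})^{1}_{2}$ fails, where $\omega\cup\{p\}$ carries the subspace topology from $\beta(\omega)$.
   Context: $\omega$ is the countably infinite discrete space, $\beta(\omega)$ its Stone-Čech compactification, and $\omega^{*}=\beta(\omega)\setminus\omega$ with the subspace topology. For topological spaces $X,Y$, the relation $X\rightarrow(Y)^{1}_{2}$ means: whenever $X=P_0\cup P_1$, there are $i\in\{0,1\}$ and $Y'\subseteq P_i$ such that $Y'$ (with the subspace topology from $X$) is homeomorphic to $Y$. *)

theory Defs
  imports "HOL-Analysis.Analysis"
begin

definition ultrafilter :: "'a filter \<Rightarrow> bool" where
  "ultrafilter F \<longleftrightarrow> F \<noteq> bot \<and> (\<forall>P. eventually P F \<or> eventually (\<lambda>x. \<not> P x) F)"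

definition stone_set :: "nat set \<Rightarrow> nat filter set" where
  "stone_set A = {F. ultrafilter F \<and> (\<forall>\<^sub>F n in F. n \<in> A)}"

text \<open>
  The compactification is taken in its standard model, the space of all ultrafilters on \<open>nat\<close>;
  the point \<open>n\<close> is identified with the principal ultrafilter \<open>principal {n}\<close>. The characteristic
  properties of the Stone-Cech compactification are established at the end of the theory.
\<close>

definition beta_omega :: "nat filter topology" where
  "beta_omega = topology_generated_by (range stone_set)"

definition omega :: "nat filter set" where
  "omega = range (\<lambda>n. principal {n})"

definition omega_star :: "nat filter topology" where
  "omega_star = subtopology beta_omega (topspace beta_omega - omega)"

definition top_arrow :: "'a topology \<Rightarrow> 'b topology \<Rightarrow> bool" where
  "top_arrow X Y \<longleftrightarrow>
     (\<forall>P\<^sub>0 P\<^sub>1. topspace X = P\<^sub>0 \<union> P\<^sub>1 \<longrightarrow>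
        (\<exists>P\<in>{P\<^sub>0, P\<^sub>1}. \<exists>Y'\<subseteq>P. subtopology X Y' homeomorphic_space Y))"

lemma ultrafilter_not_iff:
  assumes "ultrafilter F"
  shows "eventually (\<lambda>x. \<not> P x) F \<longleftrightarrow> \<not> eventually P F"
proof -
  have False if "eventually P F" "eventually (\<lambda>x. \<not> P x) F"
    using eventually_conj[OF that] assms by (simp add: ultrafilter_def)
  then show ?thesis using assms by (auto simp: ultrafilter_def)
qed

lemma ultrafilter_principal: "ultrafilter (principal {x})"
  by (simp add: ultrafilter_def eventually_principal principal_eq_bot_iff)

lemma topspace_beta_omega: "topspace beta_omega = {F. ultrafilter F}"
proof -
  have "stone_set UNIV = {F. ultrafilter F}" by (simp add: stone_set_def)
  moreover have "stone_set A \<subseteq> {F. ultrafilter F}" for A by (auto simp: stone_set_def)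
  ultimately show ?thesis unfolding beta_omega_def topology_generated_by_topspace by blast
qed

lemma openin_stone_set: "openin beta_omega (stone_set A)"
  unfolding beta_omega_def by (simp add: topology_generated_by_Basis)

lemma stone_set_Int: "stone_set A \<inter> stone_set B = stone_set (A \<inter> B)"
  by (auto simp: stone_set_def eventually_conj_iff)

lemma stone_set_Compl: "stone_set (- A) = topspace beta_omega - stone_set A"
  by (auto simp: stone_set_def topspace_beta_omega ultrafilter_not_iff)

lemma closedin_stone_set: "closedin beta_omega (stone_set A)"
proof -
  have "topspace beta_omega - stone_set (- A) = stone_set A"
    by (auto simp: stone_set_def topspace_beta_omega ultrafilter_not_iff)
  then show ?thesis by (metis closedin_diff closedin_topspace openin_stone_set)
qed

lemma openin_beta_omega_base:
  assumes "openin beta_omega U" "F \<in> U"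
  shows "\<exists>A. F \<in> stone_set A \<and> stone_set A \<subseteq> U"
proof -
  have "generate_topology_on (range stone_set) U"
    using assms(1) by (simp add: beta_omega_def openin_topology_generated_by_iff)
  then show ?thesis using assms(2)
  proof (induction arbitrary: F)
    case Empty
    then show ?case by simp
  next
    case (Int a b)
    then obtain A B where "F \<in> stone_set A" "stone_set A \<subseteq> a" "F \<in> stone_set B" "stone_set B \<subseteq> b"
      by (meson IntD1 IntD2)
    then show ?case using stone_set_Int[of A B] by (intro exI[of _ "A \<inter> B"]) blast
  next
    case (UN K)
    then show ?case by (meson Union_iff Union_upper subset_trans)
  next
    case (Basis s)
    then show ?case by blast
  qed
qed

lemma ultrafilter_exists:
  fixes F :: "'a filter"
  assumes "F \<noteq> bot"
  shows "\<exists>U. ultrafilter U \<and> U \<le> F"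
proof -
  define A where "A = {G. G \<noteq> bot \<and> G \<le> F}"
  have "\<exists>m\<in>A. \<forall>a\<in>A. m \<ge> a \<longrightarrow> a = m"
  proof (rule predicate_Zorn)
    show "partial_order_on A (relation_of (\<ge>) A)"
      by (rule partial_order_on_relation_ofI) auto
  next
    fix C assume C: "C \<in> Chains (relation_of (\<ge>) A)"
    then have CA: "C \<subseteq> A" and lin: "\<And>x y. x \<in> C \<Longrightarrow> y \<in> C \<Longrightarrow> x \<le> y \<or> y \<le> x"
      by (auto simp: Chains_def relation_of_def)
    show "\<exists>u\<in>A. \<forall>a\<in>C. a \<ge> u"
    proof (cases "C = {}")
      case True
      then show ?thesis using assms by (auto simp: A_def)
    next
      case False
      have ev: "eventually P (Inf C) \<longleftrightarrow> (\<exists>b\<in>C. eventually P b)" for P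
      proof (rule eventually_Inf_base[OF False])
        fix G H assume "G \<in> C" "H \<in> C"
        then show "\<exists>x\<in>C. x \<le> inf G H" using lin[of G H] by (metis inf.absorb1 inf.absorb2 order_refl)
      qed
      have "Inf C \<noteq> bot"
        using ev[of "\<lambda>_. False"] CA by (auto simp: A_def)
      moreover obtain c where "c \<in> C" using False by blast
      then have "Inf C \<le> F" using CA by (auto simp: A_def intro: Inf_lower2)
      ultimately show ?thesis by (intro bexI[of _ "Inf C"]) (auto simp: A_def Inf_lower)
    qed
  qed
  then obtain U where U: "U \<noteq> bot" "U \<le> F" and max: "\<And>G. G \<noteq> bot \<Longrightarrow> G \<le> U \<Longrightarrow> G = U"
    unfolding A_def by (metis (mono_tags, lifting) mem_Collect_eq order_trans)
  have "eventually P U \<or> eventually (\<lambda>x. \<not> P x) U" for P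
  proof (cases "inf U (principal {x. P x}) = bot")
    case True
    then have "eventually (\<lambda>x. \<not> P x) U"
      by (simp add: trivial_limit_def eventually_inf_principal)
    then show ?thesis ..
  next
    case False
    then have "inf U (principal {x. P x}) = U" by (intro max) auto
    then have "U \<le> principal {x. P x}" by (simp add: inf.absorb_iff1)
    then have "eventually P U" by (simp add: le_principal)
    then show ?thesis ..
  qed
  with U show ?thesis unfolding ultrafilter_def by blast
qed

theorem compact_space_beta_omega: "compact_space beta_omega"
  unfolding compact_space_alt
proof (intro allI impI)
  fix \<U> assume \<U>: "(\<forall>U\<in>\<U>. openin beta_omega U) \<and> topspace beta_omega \<subseteq> \<Union>\<U>"
  define \<A> where "\<A> = {A. \<exists>U\<in>\<U>. stone_set A \<subseteq> U}"
  define F where "F = (INF A\<in>\<A>. principal (- A))"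
  have "F = bot"
  proof (rule ccontr)
    assume "F \<noteq> bot"
    then obtain G where G: "ultrafilter G" "G \<le> F" using ultrafilter_exists by blast
    then obtain U where U: "U \<in> \<U>" "G \<in> U" using \<U> by (auto simp: topspace_beta_omega)
    then obtain A where A: "G \<in> stone_set A" "stone_set A \<subseteq> U"
      using \<U> openin_beta_omega_base by metis
    with U have "A \<in> \<A>" by (auto simp: \<A>_def)
    then have "G \<le> principal (- A)" using G(2) unfolding F_def by (meson INF_lower2 order_refl order_trans)
    then show False using A(1) G(1) by (auto simp: le_principal stone_set_def ultrafilter_not_iff)
  qed
  then have "eventually (\<lambda>_. False) F" by simp
  then obtain X where X: "finite X" "X \<subseteq> \<A>" "eventually (\<lambda>_. False) (INF A\<in>X. principal (- A))"
    unfolding F_def eventually_INF[of _ _ \<A>] by blast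
  have cov: "\<Union>X = UNIV"
    using X(3) by (auto simp: INF_principal_finite[OF X(1)] eventually_principal)
  have "\<forall>A\<in>X. \<exists>U. U \<in> \<U> \<and> stone_set A \<subseteq> U"
    using X(2) by (auto simp: \<A>_def)
  then obtain f where f: "\<And>A. A \<in> X \<Longrightarrow> f A \<in> \<U> \<and> stone_set A \<subseteq> f A"
    using bchoice[of X "\<lambda>A U. U \<in> \<U> \<and> stone_set A \<subseteq> U"] by blast
  show "\<exists>\<F>. finite \<F> \<and> \<F> \<subseteq> \<U> \<and> topspace beta_omega \<subseteq> \<Union>\<F>"
  proof (intro exI conjI)
    show "finite (f ` X)" using X by simp
    show "f ` X \<subseteq> \<U>" using f by blast
    show "topspace beta_omega \<subseteq> \<Union>(f ` X)"
    proof
      fix G assume "G \<in> topspace beta_omega"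
      then have G: "ultrafilter G" by (simp add: topspace_beta_omega)
      have "\<exists>A\<in>X. eventually (\<lambda>n. n \<in> A) G"
      proof (rule ccontr)
        assume "\<not> ?thesis"
        then have "\<forall>A\<in>X. eventually (\<lambda>n. n \<notin> A) G" using G by (simp add: ultrafilter_not_iff)
        then have "eventually (\<lambda>n. \<forall>A\<in>X. n \<notin> A) G" using X(1) by (simp add: eventually_ball_finite)
        moreover have "(\<forall>A\<in>X. n \<notin> A) \<longleftrightarrow> False" for n using cov by auto
        ultimately have "eventually (\<lambda>_. False) G" by simp
        then show False using G by (simp add: ultrafilter_def)
      qed
      then show "G \<in> \<Union>(f ` X)" using f G by (auto simp: stone_set_def)
    qed
  qed
qed

theorem Hausdorff_space_beta_omega: "Hausdorff_space beta_omega"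
  unfolding Hausdorff_space_def
proof (intro allI impI, elim conjE)
  fix F G assume FG: "F \<in> topspace beta_omega" "G \<in> topspace beta_omega" "F \<noteq> G"
  then have u: "ultrafilter F" "ultrafilter G" by (auto simp: topspace_beta_omega)
  obtain P where P: "eventually P F" "\<not> eventually P G"
    using FG(3) u by (metis filter_eq_iff ultrafilter_not_iff)
  show "\<exists>U V. openin beta_omega U \<and> openin beta_omega V \<and> F \<in> U \<and> G \<in> V \<and> disjnt U V"
  proof (intro exI conjI)
    show "F \<in> stone_set {n. P n}" "G \<in> stone_set (- {n. P n})"
      using P u by (auto simp: stone_set_def ultrafilter_not_iff)
    show "disjnt (stone_set {n. P n}) (stone_set (- {n. P n}))"
      by (auto simp: stone_set_Compl disjnt_def)
  qed (rule openin_stone_set)+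
qed

theorem embedding_map_principal:
  "embedding_map (discrete_topology UNIV) beta_omega (\<lambda>n. principal {n})"
proof -
  let ?e = "\<lambda>n::nat. principal {n}"
  have img: "?e ` A = stone_set A \<inter> omega" for A
    by (auto simp: omega_def stone_set_def ultrafilter_principal eventually_principal)
  have "inj ?e"
    by (rule injI) (metis order_refl principal_le_iff singletonD singletonI subsetD)
  moreover have "continuous_map (discrete_topology UNIV) (subtopology beta_omega omega) ?e"
    by (auto simp: continuous_map_from_discrete_topology topspace_beta_omega omega_def ultrafilter_principal)
  moreover have "open_map (discrete_topology UNIV) (subtopology beta_omega omega) ?e"
    unfolding open_map_def img by (auto simp: openin_subtopology intro: openin_stone_set)
  moreover have "?e ` UNIV = topspace (subtopology beta_omega omega)"
    by (auto simp: topspace_beta_omega omega_def ultrafilter_principal)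
  ultimately show ?thesis
    unfolding embedding_map_def omega_def
    by (intro bijective_open_imp_homeomorphic_map) simp_all
qed

theorem dense_omega: "beta_omega closure_of omega = topspace beta_omega"
proof -
  have "omega \<inter> U \<noteq> {}" if U: "openin beta_omega U" "U \<noteq> {}" for U
  proof -
    obtain F where "F \<in> U" using U by blast
    then obtain A where A: "F \<in> stone_set A" "stone_set A \<subseteq> U"
      using U openin_beta_omega_base by metis
    have "A \<noteq> {}" using A(1) by (auto simp: stone_set_def ultrafilter_def)
    then obtain n where "n \<in> A" by blast
    then have "principal {n} \<in> stone_set A"
      by (simp add: stone_set_def ultrafilter_principal eventually_principal)
    then show ?thesis using A(2) by (auto simp: omega_def)
  qed
  then show ?thesis by (simp add: dense_intersects_open)
qed

theorem beta_omega_extension: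
  fixes K :: "'b topology" and f :: "nat \<Rightarrow> 'b"
  assumes K: "compact_space K" "Hausdorff_space K" and f: "\<And>n. f n \<in> topspace K"
  shows "\<exists>g. continuous_map beta_omega K g \<and> (\<forall>n. g (principal {n}) = f n)"
proof -
  define L where "L F x \<longleftrightarrow> x \<in> topspace K \<and> (\<forall>U. openin K U \<and> x \<in> U \<longrightarrow> eventually (\<lambda>n. f n \<in> U) F)"
    for F x
  have ex: "\<exists>x. L F x" if F: "ultrafilter F" for F
  proof (rule ccontr)
    assume "\<nexists>x. L F x"
    then have "\<forall>x\<in>topspace K. \<exists>U. openin K U \<and> x \<in> U \<and> \<not> eventually (\<lambda>n. f n \<in> U) F"
      by (auto simp: L_def)
    then obtain U where U: "\<And>x. x \<in> topspace K \<Longrightarrow> openin K (U x) \<and> x \<in> U x \<and> \<not> eventually (\<lambda>n. f n \<in> U x) F"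
      by metis
    obtain \<F> where \<F>: "finite \<F>" "\<F> \<subseteq> U ` topspace K" "topspace K \<subseteq> \<Union>\<F>"
      using K(1)[unfolded compact_space_alt, rule_format, of "U ` topspace K"] U by blast
    have "\<forall>V\<in>\<F>. eventually (\<lambda>n. f n \<notin> V) F"
      using \<F>(2) U F by (auto simp: ultrafilter_not_iff)
    then have "eventually (\<lambda>n. \<forall>V\<in>\<F>. f n \<notin> V) F" using \<F>(1) by (simp add: eventually_ball_finite)
    moreover have "(\<forall>V\<in>\<F>. f n \<notin> V) \<longleftrightarrow> False" for n using \<F>(3) f[of n] by auto
    ultimately have "eventually (\<lambda>_. False) F" by simp
    then show False using F by (simp add: ultrafilter_def)
  qed
  define g where "g F = (SOME x. L F x)" for F
  have g: "L F (g F)" if "ultrafilter F" for F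
    unfolding g_def using ex[OF that] by (rule someI_ex)
  have ext: "g (principal {n}) = f n" for n
  proof (rule ccontr)
    assume ne: "g (principal {n}) \<noteq> f n"
    have Lg: "L (principal {n}) (g (principal {n}))" by (rule g[OF ultrafilter_principal])
    then obtain U V where "openin K U" "openin K V" "g (principal {n}) \<in> U" "f n \<in> V" "disjnt U V"
      using K(2) f ne unfolding Hausdorff_space_def L_def by metis
    then show False using Lg by (auto simp: L_def eventually_principal disjnt_iff)
  qed
  have "continuous_map beta_omega K g"
    unfolding continuous_map_def
  proof (intro conjI allI impI)
    show "g \<in> topspace beta_omega \<rightarrow> topspace K" using g by (auto simp: topspace_beta_omega L_def)
    fix W assume W: "openin K W"
    show "openin beta_omega {F \<in> topspace beta_omega. g F \<in> W}"
    proof (subst openin_subopen, intro ballI)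
      fix F assume "F \<in> {F \<in> topspace beta_omega. g F \<in> W}"
      then have F: "ultrafilter F" "g F \<in> W" by (auto simp: topspace_beta_omega)
      have "neighbourhood_base_of (closedin K) K"
        using K by (simp add: neighbourhood_base_of_closedin compact_Hausdorff_imp_regular_space)
      then obtain U C where UC: "openin K U" "closedin K C" "g F \<in> U" "U \<subseteq> C" "C \<subseteq> W"
        using W F unfolding neighbourhood_base_of by metis
      have "g G \<in> W" if G: "G \<in> stone_set {n. f n \<in> U}" for G
      proof (rule ccontr)
        assume "g G \<notin> W"
        have uG: "ultrafilter G" and eG: "eventually (\<lambda>n. f n \<in> U) G" using G by (auto simp: stone_set_def)
        have "openin K (topspace K - C)" "g G \<in> topspace K - C"
          using UC \<open>g G \<notin> W\<close> g[OF uG] by (auto simp: L_def)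
        then have "eventually (\<lambda>n. f n \<in> topspace K - C) G" using g[OF uG] unfolding L_def by blast
        then have "eventually (\<lambda>n. False) G" using eG by eventually_elim (use UC in auto)
        then show False using uG by (simp add: ultrafilter_def)
      qed
      moreover have "F \<in> stone_set {n. f n \<in> U}" using F UC g[OF F(1)] by (auto simp: stone_set_def L_def)
      ultimately show "\<exists>T. openin beta_omega T \<and> F \<in> T \<and> T \<subseteq> {F \<in> topspace beta_omega. g F \<in> W}"
        by (intro exI[of _ "stone_set {n. f n \<in> U}"])
           (use openin_stone_set openin_subset in blast)
    qed
  qed
  with ext show ?thesis by blast
qed

end

theory Submission
  imports Defs
begin

text \<open>
  A copy of \<open>\<omega> \<union> {p}\<close> amounts to a point \<open>q = p-lim d\<^sub>n\<close> with a discrete sequence \<open>d\<close>. By an argument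
  of Frolik, \<open>q\<close> determines \<open>d\<close> up to changes off a set in \<open>p\<close>, and \<open>q\<close> is none of the \<open>d\<^sub>n\<close>. It
  therefore suffices to 2-colour the ultrafilters such that each such \<open>q\<close> has the colour opposite
  to that of \<open>p\<close>-almost all \<open>d\<^sub>n\<close>. Take a maximal partial colouring of this kind whose domain contains
  \<open>p\<close>-almost all \<open>d\<^sub>n\<close> together with \<open>q\<close>. If it misses some point, then every point \<open>x\<close> that it misses
  is the \<open>p\<close>-limit of a discrete sequence of missed points. Passing repeatedly to such sequences,
  and shrinking them into pairwise disjoint clopen sets, produces a tree without repetitions among
  the missed points; colouring it by the parity of the level extends the colouring.
\<close>

section \<open>Elementary facts on ultrafilters\<close>

lemma ultrafilter_eqI:
  assumes "ultrafilter F" "ultrafilter G" "\<And>P. eventually P F \<Longrightarrow> eventually P G"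
  shows "F = G"
proof -
  have "eventually P F" if "eventually P G" for P
    using assms(3)[of "\<lambda>x. \<not> P x"] that ultrafilter_not_iff[OF assms(1), of P]
      ultrafilter_not_iff[OF assms(2), of P] by blast
  then show ?thesis using assms(3) unfolding filter_eq_iff by blast
qed

lemma ultrafilter_nonprincipal_neq:
  assumes "ultrafilter F" "F \<noteq> principal {a}"
  shows "\<forall>\<^sub>F x in F. x \<noteq> a"
proof (rule ccontr)
  assume "\<not> ?thesis"
  then have "\<forall>\<^sub>F x in F. x = a"
    using ultrafilter_not_iff[OF assms(1), of "\<lambda>x. x = a"] by simp
  then have "eventually P F" if "eventually P (principal {a})" for P
    using that by (auto simp: eventually_principal elim: eventually_mono)
  then show False using assms ultrafilter_eqI ultrafilter_principal by metis
qed

subsection \<open>Maps fixing an ultrafilter\<close>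

text \<open>Connect two points when their forward orbits meet. Orbits are strictly increasing, so
  the parity of the number of steps through a meeting point is independent of that point; it is
  taken relative to the least point \<open>r n\<close> of the component.\<close>

lemma expanding_map_two_colouring:
  fixes h :: "nat \<Rightarrow> nat"
  assumes h: "\<And>n. n < h n"
  shows "\<exists>c :: nat \<Rightarrow> bool. \<forall>n. c (h n) \<noteq> c n"
proof -
  have mono: "strict_mono (\<lambda>i. (h ^^ i) n)" for n
    by (rule strict_monoI_Suc) (simp add: h)
  define E where "E n m \<longleftrightarrow> (\<exists>i j. (h ^^ i) n = (h ^^ j) m)" for n m
  define r where "r n = (LEAST m. E n m)" for n
  have "E n n" for n by (auto simp: E_def)
  then have E: "E n (r n)" for n unfolding r_def by (rule LeastI)
  have "E (h n) = E n" for n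
  proof (rule ext, rule iffI)
    fix m
    show "E n m" if Em: "E (h n) m"
    proof -
      obtain i j where "(h ^^ i) (h n) = (h ^^ j) m" using Em by (auto simp: E_def)
      then have "(h ^^ Suc i) n = (h ^^ j) m" by (simp add: funpow_swap1)
      then show ?thesis unfolding E_def by blast
    qed
    show "E (h n) m" if Em: "E n m"
    proof -
      obtain i j where "(h ^^ i) n = (h ^^ j) m" using Em by (auto simp: E_def)
      then have "(h ^^ i) (h n) = (h ^^ Suc j) m" by (simp add: funpow_swap1[symmetric])
      then show ?thesis unfolding E_def by blast
    qed
  qed
  then have r: "r (h n) = r n" for n by (simp add: r_def)
  have parity: "even (i + j) \<longleftrightarrow> even (i' + j')"
    if eq: "(h ^^ i) n = (h ^^ j) m" "(h ^^ i') n = (h ^^ j') m" for i j i' j' n m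
  proof -
    have "(h ^^ (i' + j)) m = (h ^^ i') ((h ^^ i) n)" by (simp add: funpow_add eq)
    also have "\<dots> = (h ^^ i) ((h ^^ i') n)" by (metis add.commute comp_apply funpow_add)
    also have "\<dots> = (h ^^ (i + j')) m" by (simp add: funpow_add eq)
    \<comment> \<open>The orbit of \<open>m\<close> is injective, so equal points have equal
      exponents.\<close>
    finally have "i' + j = i + j'" using strict_mono_eq[OF mono] by blast
    then show ?thesis by presburger
  qed
  define c where "c n \<longleftrightarrow> (\<exists>i j. (h ^^ i) n = (h ^^ j) (r n) \<and> even (i + j))" for n
  have c: "c n \<longleftrightarrow> even (i + j)" if "(h ^^ i) n = (h ^^ j) (r n)" for n i j
    using that parity unfolding c_def by blast
  have "c (h n) \<noteq> c n" for n
  proof -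
    obtain i j where ij: "(h ^^ i) n = (h ^^ j) (r n)" using E unfolding E_def by blast
    then have "(h ^^ i) (h n) = (h ^^ Suc j) (r (h n))" by (simp add: r funpow_swap1[symmetric])
    then show ?thesis using c[OF ij] c by fastforce
  qed
  then show ?thesis by blast
qed

text \<open>Well-founded recursion: points where \<open>h\<close> does not descend get False, all
  others the opposite of the colour of their image.\<close>

lemma regressive_map_two_colouring:
  fixes h :: "nat \<Rightarrow> nat"
  shows "\<exists>c :: nat \<Rightarrow> bool. \<forall>n. h n < n \<longrightarrow> c (h n) \<noteq> c n"
proof -
  define c where "c = wfrec less_than (\<lambda>c n. h n < n \<and> \<not> c (h n))"
  have "c n \<longleftrightarrow> h n < n \<and> \<not> c (h n)" for n
    unfolding c_def by (subst wfrec[OF wf_less_than]) (auto simp: cut_apply)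
  then show ?thesis by metis
qed

text \<open>Since \<open>p\<close> decides every colouring and \<open>h\<close> maps
  \<open>p\<close> to itself, \<open>n\<close> and \<open>h n\<close> have the same colour for
  almost all \<open>n\<close>. The two colourings above therefore exclude that \<open>h\<close>
  moves almost all points down, or almost all up.\<close>

lemma ultrafilter_fixed_map_eq_id:
  fixes p :: "nat filter"
  assumes p: "ultrafilter p" and h: "\<And>P. eventually P p \<Longrightarrow> \<forall>\<^sub>F n in p. P (h n)"
  shows "\<forall>\<^sub>F n in p. h n = n"
proof -
  have no_colouring: "\<not> (\<forall>\<^sub>F n in p. c (h n) \<noteq> c n)" for c :: "nat \<Rightarrow> bool"
  proof
    assume ne: "\<forall>\<^sub>F n in p. c (h n) \<noteq> c n"
    have "(\<forall>\<^sub>F n in p. c n = True) \<or> (\<forall>\<^sub>F n in p. c n = False)"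
      using p by (simp add: ultrafilter_def)
    then obtain b where b: "\<forall>\<^sub>F n in p. c n = b" by blast
    have "\<forall>\<^sub>F n in p. False"
      using ne b h[OF b] by eventually_elim simp
    then show False using p by (simp add: ultrafilter_def)
  qed
  obtain c :: "nat \<Rightarrow> bool" where c: "\<forall>n. h n < n \<longrightarrow> c (h n) \<noteq> c n"
    using regressive_map_two_colouring[of h] ..
  \<comment> \<open>This map is expanding everywhere and agrees with \<open>h\<close> wherever
    \<open>h\<close> moves up.\<close>
  have "n < max (h n) (Suc n)" for n by simp
  then obtain c' :: "nat \<Rightarrow> bool" where c': "\<forall>n. c' (max (h n) (Suc n)) \<noteq> c' n"
    using expanding_map_two_colouring[of "\<lambda>n. max (h n) (Suc n)"] by metis
  have "\<not> (\<forall>\<^sub>F n in p. h n < n)"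
  proof
    assume "\<forall>\<^sub>F n in p. h n < n"
    then have "\<forall>\<^sub>F n in p. c (h n) \<noteq> c n" by eventually_elim (use c in simp)
    then show False using no_colouring by simp
  qed
  moreover have "\<not> (\<forall>\<^sub>F n in p. n < h n)"
  proof
    assume "\<forall>\<^sub>F n in p. n < h n"
    then have "\<forall>\<^sub>F n in p. c' (h n) \<noteq> c' n"
    proof eventually_elim
      case (elim n)
      then have "max (h n) (Suc n) = h n" by simp
      then show ?case using c' by metis
    qed
    then show False using no_colouring by simp
  qed
  ultimately have "\<forall>\<^sub>F n in p. \<not> h n < n" "\<forall>\<^sub>F n in p. \<not> n < h n"
    using ultrafilter_not_iff[OF p] by simp_all
  then show ?thesis by eventually_elim simp
qed

subsection \<open>Limits of discrete sequences\<close>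

text \<open>Encodes discreteness by one function: its fibres are pairwise disjoint, and the
  \<open>n\<close>-th one belongs to \<open>d n\<close> alone.\<close>

definition separated_by :: "('a \<Rightarrow> nat) \<Rightarrow> (nat \<Rightarrow> 'a filter) \<Rightarrow> bool" where
  "separated_by f d \<longleftrightarrow> (\<forall>n. \<forall>\<^sub>F k in d n. f k = n)"

definition discrete_limit :: "nat filter \<Rightarrow> (nat \<Rightarrow> 'a filter) \<Rightarrow> 'a filter \<Rightarrow> bool" where
  "discrete_limit p d q \<longleftrightarrow> ultrafilter q \<and> (\<forall>n. ultrafilter (d n)) \<and> (\<exists>f. separated_by f d) \<and>
     (\<forall>P. eventually P q \<longrightarrow> (\<forall>\<^sub>F n in p. eventually P (d n)))"

lemma discrete_limitD:
  assumes "discrete_limit p d q"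
  shows "ultrafilter q" "ultrafilter (d n)" "\<exists>f. separated_by f d"
    "eventually P q \<Longrightarrow> \<forall>\<^sub>F n in p. eventually P (d n)"
  using assms by (auto simp: discrete_limit_def)

lemma discrete_limit_eventually_iff:
  assumes p: "ultrafilter p" and d: "discrete_limit p d q"
  shows "(\<forall>\<^sub>F n in p. eventually P (d n)) \<longleftrightarrow> eventually P q"
proof
  assume ev: "\<forall>\<^sub>F n in p. eventually P (d n)"
  show "eventually P q"
  proof (rule ccontr)
    assume "\<not> eventually P q"
    then have "\<forall>\<^sub>F n in p. eventually (\<lambda>k. \<not> P k) (d n)"
      using discrete_limitD(1,4)[OF d] ultrafilter_not_iff[of q P] by blast
    then have "\<forall>\<^sub>F n in p. False"
      using ev by eventually_elim (use discrete_limitD(2)[OF d] in \<open>simp add: ultrafilter_not_iff\<close>)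
    then show False using p by (simp add: ultrafilter_def)
  qed
qed (rule discrete_limitD(4)[OF d])

text \<open>As \<open>f\<close> is constantly \<open>n\<close> along \<open>d n\<close>, it pushes
  \<open>q\<close> forward to \<open>p\<close>; thus \<open>p\<close> can be recovered from
  \<open>q\<close>.\<close>

lemma discrete_limit_separated:
  assumes p: "ultrafilter p" and d: "discrete_limit p d q" and f: "separated_by f d"
  shows "(\<forall>\<^sub>F k in q. P (f k)) \<longleftrightarrow> eventually P p"
proof -
  have "eventually (\<lambda>k. P (f k)) (d n) \<longleftrightarrow> P n" for n
  proof -
    have "eventually (\<lambda>k. P (f k)) (d n) \<longleftrightarrow> eventually (\<lambda>k. P n) (d n)"
      by (rule eventually_cong[of "\<lambda>k. f k = n"]) (use f in \<open>auto simp: separated_by_def\<close>)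
    then show ?thesis using discrete_limitD(2)[OF d, of n]
      by (auto simp: ultrafilter_def eventually_const)
  qed
  then show ?thesis using discrete_limit_eventually_iff[OF p d, of "\<lambda>k. P (f k)"] by simp
qed

text \<open>The image of \<open>q\<close> under \<open>f\<close> is the nonprincipal
  \<open>p\<close>. This keeps \<open>q\<close> apart from every ultrafilter that contains a
  fibre.\<close>

lemma discrete_limit_not_fibre:
  assumes p: "ultrafilter p" "p \<noteq> principal {n}" and d: "discrete_limit p d q" "separated_by f d"
  shows "\<not> (\<forall>\<^sub>F k in q. f k = n)"
  using discrete_limit_separated[OF p(1) d, of "\<lambda>m. m = n"] ultrafilter_nonprincipal_neq[OF p]
    ultrafilter_not_iff[OF p(1), of "\<lambda>m. m = n"] by simp

text \<open>The hypothesis \<open>cl\<close> says that almost all \<open>d n\<close> lie in the closure of \<open>range e\<close>.\<close>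

lemma discrete_limit_unique_if_in_closure:
  assumes p: "ultrafilter p" and d: "discrete_limit p d q" and e: "discrete_limit p e q"
    and cl: "\<forall>\<^sub>F n in p. \<forall>P. eventually P (d n) \<longrightarrow> (\<exists>m. eventually P (e m))"
  shows "\<forall>\<^sub>F n in p. d n = e n"
proof -
  obtain f g where f: "separated_by f d" and g: "separated_by g e"
    using d e by (meson discrete_limitD(3))
  have fn: "\<forall>\<^sub>F k in d n. f k = n" and gn: "\<forall>\<^sub>F k in e n. g k = n" for n
    using f g by (simp_all add: separated_by_def)
  \<comment> \<open>The index of the fibre of \<open>f\<close> that contains \<open>e m\<close>;
    arbitrary if no fibre does.\<close>
  define h where "h m = (SOME n. \<forall>\<^sub>F k in e m. f k = n)" for m
  have h: "h m = n" if n: "\<forall>\<^sub>F k in e m. f k = n" for m n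
  proof -
    have "\<forall>\<^sub>F k in e m. f k = h m" unfolding h_def using n by (rule someI)
    with n have "\<forall>\<^sub>F k in e m. h m = n" by eventually_elim simp
    then show ?thesis using discrete_limitD(2)[OF e, of m] by (simp add: ultrafilter_def eventually_const)
  qed
  \<comment> \<open>A point \<open>e m\<close> near \<open>d n\<close> can be found inside the
    \<open>n\<close>-th fibre of \<open>f\<close>. As \<open>g\<close> is constantly
    \<open>m\<close> along \<open>e m\<close>, a property of \<open>g k\<close> that holds along
    \<open>d n\<close> passes to the index \<open>m\<close>.\<close>
  have witness: "\<exists>m. eventually P (e m) \<and> h m = n \<and> Y m"
    if n: "\<forall>P. eventually P (d n) \<longrightarrow> (\<exists>m. eventually P (e m))"
      and P: "eventually P (d n)" and Y: "\<forall>\<^sub>F k in d n. Y (g k)" for n P Y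
  proof -
    have "\<forall>\<^sub>F k in d n. P k \<and> f k = n \<and> Y (g k)"
      using P Y fn[of n] by eventually_elim simp
    then obtain m where m: "\<forall>\<^sub>F k in e m. P k \<and> f k = n \<and> Y (g k)" using n by blast
    have "\<forall>\<^sub>F k in e m. Y m" using m gn[of m] by eventually_elim auto
    then have "Y m" using discrete_limitD(2)[OF e, of m] by (simp add: ultrafilter_def eventually_const)
    moreover have "h m = n" by (rule h) (use m in \<open>auto elim: eventually_mono\<close>)
    moreover have "eventually P (e m)" using m by (auto elim: eventually_mono)
    ultimately show ?thesis by blast
  qed
  have lift: "\<forall>\<^sub>F n in p. \<forall>\<^sub>F k in d n. Y (g k)" if "eventually Y p" for Y
    using discrete_limit_separated[OF p e g] discrete_limitD(4)[OF d] that by blast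
  \<comment> \<open>It suffices that \<open>h\<close> fixes \<open>p\<close>. Otherwise some
    \<open>n\<close> satisfies \<open>X\<close> while a witness \<open>m\<close> with
    \<open>h m = n\<close> violates \<open>X (h m)\<close>.\<close>
  have "\<forall>\<^sub>F m in p. h m = m"
  proof (rule ultrafilter_fixed_map_eq_id[OF p])
    fix X assume X: "eventually X p"
    show "\<forall>\<^sub>F m in p. X (h m)"
    proof (rule ccontr)
      assume "\<not> ?thesis"
      then have Y: "\<forall>\<^sub>F m in p. \<not> X (h m)" using p by (simp add: ultrafilter_not_iff)
      have "\<forall>\<^sub>F n in p. False" using X cl lift[OF Y]
      proof eventually_elim
        case (elim n)
        then show ?case using witness[of n "\<lambda>_. True" "\<lambda>m. \<not> X (h m)"] by auto
      qed
      then show False using p by (simp add: ultrafilter_def)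
    qed
  qed
  \<comment> \<open>The witnesses may now be chosen with \<open>h m = m\<close>, so
    \<open>m = n\<close> and every member of \<open>d n\<close> belongs to
    \<open>e n\<close>.\<close>
  from cl lift[OF this] show ?thesis
  proof eventually_elim
    case (elim n)
    show ?case
    proof (rule ultrafilter_eqI)
      show "eventually P (e n)" if "eventually P (d n)" for P
        using witness[OF elim(1) that elim(2)] by metis
    qed (use d e in \<open>simp_all add: discrete_limitD(2)\<close>)
  qed
qed

text \<open>
  If almost no \<open>d n\<close> were in the closure of \<open>range e\<close> and vice versa, two separated countable sets
  would have disjoint closures, but \<open>q\<close> is in both.
\<close>

lemma discrete_limit_unique:
  assumes p: "ultrafilter p" and d: "discrete_limit p d q" and e: "discrete_limit p e q"
  shows "\<forall>\<^sub>F n in p. d n = e n"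
proof -
  define C where "C d e n \<longleftrightarrow> (\<forall>P. eventually P (d n) \<longrightarrow> (\<exists>m. eventually P (e m)))"
    for d e :: "nat \<Rightarrow> 'a filter" and n :: nat
  have "eventually (C d e) p \<or> eventually (C e d) p"
  proof (rule ccontr)
    assume "\<not> ?thesis"
    then have X: "\<forall>\<^sub>F n in p. \<not> C d e n" and Y: "\<forall>\<^sub>F n in p. \<not> C e d n"
      using p by (simp_all add: ultrafilter_not_iff)
    have "\<forall>n. \<exists>P. \<not> C d e n \<longrightarrow> eventually P (d n) \<and> (\<forall>m. \<not> eventually P (e m))"
      by (auto simp: C_def)
    then obtain A where A: "\<And>n. \<not> C d e n \<Longrightarrow> eventually (A n) (d n) \<and> (\<forall>m. \<not> eventually (A n) (e m))"
      unfolding choice_iff by blast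
    have "\<forall>n. \<exists>P. \<not> C e d n \<longrightarrow> eventually P (e n) \<and> (\<forall>m. \<not> eventually P (d m))"
      by (auto simp: C_def)
    then obtain B where B: "\<And>n. \<not> C e d n \<Longrightarrow> eventually (B n) (e n) \<and> (\<forall>m. \<not> eventually (B n) (d m))"
      unfolding choice_iff by blast
    \<comment> \<open>Removing from each \<open>A n\<close> the finitely many \<open>B m\<close>
      with \<open>m \<le> n\<close>, and symmetrically, makes the unions disjoint: of two indices
      one is at most the other. Each \<open>d n\<close> still contains its trimmed set, as it
      contains no \<open>B m\<close>.\<close>
    define U where "U k \<longleftrightarrow> (\<exists>n. \<not> C d e n \<and> A n k \<and> (\<forall>m\<le>n. \<not> C e d m \<longrightarrow> \<not> B m k))" for k
    define V where "V k \<longleftrightarrow> (\<exists>n. \<not> C e d n \<and> B n k \<and> (\<forall>m\<le>n. \<not> C d e m \<longrightarrow> \<not> A m k))" for k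
    have "eventually U (d n)" if n: "\<not> C d e n" for n
    proof -
      have "\<forall>\<^sub>F k in d n. \<not> C e d m \<longrightarrow> \<not> B m k" for m
        using B[of m] discrete_limitD(2)[OF d, of n] by (cases "C e d m") (auto simp: ultrafilter_not_iff)
      then have "\<forall>\<^sub>F k in d n. \<forall>m\<in>{..n}. \<not> C e d m \<longrightarrow> \<not> B m k"
        by (intro eventually_ball_finite) auto
      moreover have "eventually (A n) (d n)" using A n by blast
      ultimately show ?thesis by eventually_elim (use n in \<open>auto simp: U_def\<close>)
    qed
    then have "\<forall>\<^sub>F n in p. eventually U (d n)" using X by (rule eventually_mono[rotated])
    then have evU: "eventually U q" using discrete_limit_eventually_iff[OF p d, of U] by simp
    have "eventually V (e n)" if n: "\<not> C e d n" for n
    proof -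
      have "\<forall>\<^sub>F k in e n. \<not> C d e m \<longrightarrow> \<not> A m k" for m
        using A[of m] discrete_limitD(2)[OF e, of n] by (cases "C d e m") (auto simp: ultrafilter_not_iff)
      then have "\<forall>\<^sub>F k in e n. \<forall>m\<in>{..n}. \<not> C d e m \<longrightarrow> \<not> A m k"
        by (intro eventually_ball_finite) auto
      moreover have "eventually (B n) (e n)" using B n by blast
      ultimately show ?thesis by eventually_elim (use n in \<open>auto simp: V_def\<close>)
    qed
    then have "\<forall>\<^sub>F n in p. eventually V (e n)" using Y by (rule eventually_mono[rotated])
    then have "eventually V q" using discrete_limit_eventually_iff[OF p e, of V] by simp
    with evU have "\<forall>\<^sub>F k in q. U k \<and> V k" by (rule eventually_conj)
    moreover have "\<not> (U k \<and> V k)" for k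
      unfolding U_def V_def by (metis nat_le_linear)
    ultimately show False using discrete_limitD(1)[OF d] by (simp add: ultrafilter_def)
  qed
  then show ?thesis
  proof
    assume "eventually (C d e) p"
    then show ?thesis using discrete_limit_unique_if_in_closure[OF p d e] unfolding C_def by blast
  next
    assume "eventually (C e d) p"
    then have "\<forall>\<^sub>F n in p. e n = d n"
      using discrete_limit_unique_if_in_closure[OF p e d] unfolding C_def by blast
    then show ?thesis by (simp add: eq_commute)
  qed
qed

subsection \<open>The colouring\<close>

text \<open>
  \<open>descendant M d f x K y b\<close>: the point \<open>y\<close> is reached from \<open>x\<close> by repeatedly passing from a point
  \<open>z\<close> to a member of the sequence \<open>d z\<close> outside \<open>M\<close>, never leaving the current clopen set \<open>K\<close>, which
  shrinks to a fibre of \<open>f z\<close> in each step; \<open>b\<close> is the parity of the number of steps.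
\<close>

inductive descendant for M :: "'a filter set" and d :: "'a filter \<Rightarrow> nat \<Rightarrow> 'a filter"
  and f :: "'a filter \<Rightarrow> 'a \<Rightarrow> nat" where
  root: "descendant M d f x K x False"
| step: "d x n \<notin> M \<Longrightarrow> eventually K (d x n) \<Longrightarrow>
    descendant M d f (d x n) (\<lambda>k. K k \<and> f x k = n) y b \<Longrightarrow> descendant M d f x K y (\<not> b)"

text \<open>\<open>M\<close> will be the domain of a maximal partial colouring; \<open>d\<close> and
  \<open>f\<close> choose for each missed point a sequence of mostly missed points and a separating
  function.\<close>

locale missed_points =
  fixes p :: "nat filter" and M :: "'a filter set" and d f
  assumes p: "ultrafilter p" "\<And>n. p \<noteq> principal {n}"
    and lim: "\<And>x. x \<notin> M \<Longrightarrow> discrete_limit p (d x) x"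
    and sep: "\<And>x. x \<notin> M \<Longrightarrow> separated_by (f x) (d x)"
    and missed: "\<And>x. x \<notin> M \<Longrightarrow> \<forall>\<^sub>F n in p. d x n \<notin> M"
begin

lemma eventually_fibre: "x \<notin> M \<Longrightarrow> eventually K (d x n) \<Longrightarrow> \<forall>\<^sub>F k in d x n. K k \<and> f x k = n"
  using sep by (auto simp: separated_by_def intro: eventually_conj)

lemma descendant_inside:
  "descendant M d f x K y b \<Longrightarrow> x \<notin> M \<Longrightarrow> eventually K x \<Longrightarrow> y \<notin> M \<and> eventually K y"
proof (induction rule: descendant.induct)
  case (step x n K y b)
  then show ?case using eventually_fibre[of x K n] by (auto elim: eventually_mono)
qed simp

lemma descendant_step_fibre:
  assumes "descendant M d f (d x n) (\<lambda>k. K k \<and> f x k = n) y b" "x \<notin> M" "d x n \<notin> M"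
    "eventually K (d x n)"
  shows "\<forall>\<^sub>F k in y. f x k = n"
proof -
  have "\<forall>\<^sub>F k in y. K k \<and> f x k = n"
    using descendant_inside[OF assms(1,3)] eventually_fibre[OF assms(2,4)] by blast
  then show ?thesis by eventually_elim simp
qed

text \<open>The end of a path lies in the fibre chosen at its first step. So it differs from
  \<open>x\<close>, which lies in no fibre, and it determines that step; induction handles the rest
  of the path.\<close>

lemma descendant_parity_unique:
  "descendant M d f x K y b \<Longrightarrow> descendant M d f x K y b' \<Longrightarrow> x \<notin> M \<Longrightarrow> b = b'"
proof (induction arbitrary: b' rule: descendant.induct)
  case (root x K)
  from root.prems(1) show ?case
  proof cases
    case (step n b)
    then show ?thesis
      using descendant_step_fibre root.prems(2) discrete_limit_not_fibre[OF p lim sep] by metis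
  qed simp
next
  case (step x n K y b)
  note n = step.hyps and IH = step.IH and x = step.prems(2)
  have y: "\<forall>\<^sub>F k in y. f x k = n"
    using descendant_step_fibre[OF n(3) x n(1,2)] .
  from step.prems(1) show ?case
  proof cases
    case root
    then show ?thesis
      using y x discrete_limit_not_fibre[OF p lim sep] by metis
  next
    case (step m c)
    have "\<forall>\<^sub>F k in y. f x k = m"
      using descendant_step_fibre[OF step(4) x step(2,3)] .
    with y have "\<forall>\<^sub>F k in y. m = n" by eventually_elim simp
    moreover have "y \<notin> M"
      using descendant_inside[OF n(3,1)] eventually_fibre[OF x n(2)] by blast
    then have "y \<noteq> bot" using discrete_limitD(1)[OF lim] by (auto simp: ultrafilter_def)
    ultimately have "m = n" by (simp add: eventually_const)
    then show ?thesis using IH[of c] step n(1) by simp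
  qed
qed

text \<open>Every set in the limit \<open>y\<close> is in almost all \<open>d y n\<close>, so almost
  all of them stay inside the set that the path has reached, and the path can be prolonged by one
  step.\<close>

lemma descendant_children:
  "descendant M d f x K y b \<Longrightarrow> x \<notin> M \<Longrightarrow> eventually K x \<Longrightarrow>
    \<forall>\<^sub>F n in p. descendant M d f x K (d y n) (\<not> b)"
proof (induction rule: descendant.induct)
  case (root x K)
  have "\<forall>\<^sub>F n in p. eventually K (d x n)"
    using discrete_limitD(4)[OF lim] root by blast
  with missed[OF root(1)] show ?case
    by eventually_elim (rule descendant.step[OF _ _ descendant.root])
next
  case (step x n K y b)
  then have "\<forall>\<^sub>F m in p. descendant M d f (d x n) (\<lambda>k. K k \<and> f x k = n) (d y m) (\<not> b)"
    using eventually_fibre by blast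
  then show ?case by eventually_elim (rule descendant.step[of d x n M K, OF step.hyps(1,2)])
qed

end

lemma discrete_limit_two_colouring:
  fixes p :: "nat filter"
  assumes p: "ultrafilter p" "\<And>n. p \<noteq> principal {n}"
  shows "\<exists>c :: 'a filter \<Rightarrow> bool. \<forall>d q. discrete_limit p d q \<longrightarrow> (\<forall>\<^sub>F n in p. c (d n) \<noteq> c q)"
proof -
  \<comment> \<open>Partial colourings as relations, so that Zorn's lemma applies to inclusion; the
    domain must absorb almost all terms of each sequence converging to one of its points.\<close>
  define good where "good G \<longleftrightarrow> single_valued G \<and>
      (\<forall>(x, b)\<in>G. \<forall>d. discrete_limit p d x \<longrightarrow> (\<forall>\<^sub>F n in p. (d n, \<not> b) \<in> G))"
    for G :: "('a filter \<times> bool) set"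
  have "\<exists>G\<in>Collect good. \<forall>H\<in>Collect good. G \<subseteq> H \<longrightarrow> H = G"
  proof (rule subset_Zorn')
    fix \<C> assume \<C>: "subset.chain (Collect good) \<C>"
    have "single_valued (\<Union>\<C>)"
    proof (rule single_valuedI)
      fix x b b' assume "(x, b) \<in> \<Union>\<C>" "(x, b') \<in> \<Union>\<C>"
      then obtain G H where "G \<in> \<C>" "H \<in> \<C>" "(x, b) \<in> G" "(x, b') \<in> H" by blast
      moreover from this have "G \<subseteq> H \<or> H \<subseteq> G" "single_valued G" "single_valued H"
        using \<C> by (auto simp: subset_chain_def good_def)
      ultimately show "b = b'" by (metis single_valuedD subsetD)
    qed
    moreover have "\<forall>\<^sub>F n in p. (d n, \<not> b) \<in> \<Union>\<C>"
      if xb: "(x, b) \<in> \<Union>\<C>" and d: "discrete_limit p d x" for x b d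
    proof -
      obtain G where G: "G \<in> \<C>" "(x, b) \<in> G" using xb by blast
      then have "\<forall>\<^sub>F n in p. (d n, \<not> b) \<in> G"
        using \<C> d by (fastforce simp: subset_chain_def good_def)
      then show ?thesis by eventually_elim (use G in blast)
    qed
    ultimately show "\<Union>\<C> \<in> Collect good" by (auto simp: good_def)
  qed
  then obtain G where G: "good G" and max: "\<And>H. good H \<Longrightarrow> G \<subseteq> H \<Longrightarrow> H = G" by blast
  have sv: "b = b'" if "(x, b) \<in> G" "(x, b') \<in> G" for x b b'
    using G that by (auto simp: good_def dest: single_valuedD)
  have Gd: "\<forall>\<^sub>F n in p. (d n, \<not> b) \<in> G" if "(x, b) \<in> G" "discrete_limit p d x" for x b d
    using G that by (auto simp: good_def)
  \<comment> \<open>By maximality, a point that could consistently receive a colour already has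
    one.\<close>
  have extend: "x \<in> Domain G"
    if "\<And>d. discrete_limit p d x \<Longrightarrow> \<forall>\<^sub>F n in p. (d n, \<not> b) \<in> G" for x b
  proof (rule ccontr)
    assume x: "x \<notin> Domain G"
    have "good (insert (x, b) G)"
      unfolding good_def
    proof (intro conjI ballI, goal_cases)
      case 1
      show ?case using sv x by (auto simp: single_valued_def)
    next
      case (2 z)
      have "\<forall>\<^sub>F n in p. (d n, \<not> b') \<in> insert (x, b) G"
        if zb: "(z, b') \<in> insert (x, b) G" and d: "discrete_limit p d z" for z b' d
      proof -
        have "\<forall>\<^sub>F n in p. (d n, \<not> b') \<in> G"
          using zb d Gd \<open>\<And>d. discrete_limit p d x \<Longrightarrow> \<forall>\<^sub>F n in p. (d n, \<not> b) \<in> G\<close> by blast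
        then show ?thesis by eventually_elim simp
      qed
      with 2 show ?case by blast
    qed
    then have "insert (x, b) G = G" by (rule max) auto
    then show False using x by auto
  qed
  have ex: "\<exists>d f. discrete_limit p d x \<and> separated_by f d \<and> (\<forall>\<^sub>F n in p. d n \<notin> Domain G)"
    if x: "x \<notin> Domain G" for x
  proof -
    obtain d where d: "discrete_limit p d x" using extend x by blast
    \<comment> \<open>Otherwise almost all \<open>d n\<close> share one colour, and by uniqueness so
      do almost all terms of any other sequence with limit \<open>x\<close>; then \<open>x\<close>
      could take the opposite colour.\<close>
    have "\<forall>\<^sub>F n in p. d n \<notin> Domain G"
    proof (rule ccontr)
      assume "\<not> ?thesis"
      then have dom: "\<forall>\<^sub>F n in p. d n \<in> Domain G"
        using ultrafilter_not_iff[OF p(1), of "\<lambda>n. d n \<in> Domain G"] by simp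
      have "\<exists>b. \<forall>\<^sub>F n in p. (d n, \<not> b) \<in> G"
      proof (cases "\<forall>\<^sub>F n in p. (d n, True) \<in> G")
        case True
        then show ?thesis by (intro exI[of _ False]) simp
      next
        case False
        then have "\<forall>\<^sub>F n in p. (d n, True) \<notin> G" using p by (simp add: ultrafilter_not_iff)
        with dom have "\<forall>\<^sub>F n in p. (d n, \<not> True) \<in> G"
          by eventually_elim (metis (full_types) DomainE)
        then show ?thesis by blast
      qed
      then obtain b where b: "\<forall>\<^sub>F n in p. (d n, \<not> b) \<in> G" ..
      have "\<forall>\<^sub>F n in p. (e n, \<not> b) \<in> G" if "discrete_limit p e x" for e
        using b discrete_limit_unique[OF p(1) d that] by eventually_elim simp
      then show False using extend x by blast
    qed
    then show ?thesis using d discrete_limitD(3) by blast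
  qed
  have total: "x \<in> Domain G" for x
  proof (rule ccontr)
    assume x: "x \<notin> Domain G"
    obtain d f where df: "\<And>x. x \<notin> Domain G \<Longrightarrow>
        discrete_limit p (d x) x \<and> separated_by (f x) (d x) \<and> (\<forall>\<^sub>F n in p. d x n \<notin> Domain G)"
      using ex by metis
    interpret missed_points p "Domain G" d f
      by unfold_locales (use p df in auto)
    \<comment> \<open>The tree below \<open>x\<close>, started in the whole space and coloured by
      level parity.\<close>
    define T where "T = {(y, b). descendant (Domain G) d f x (\<lambda>_. True) y b}"
    have T: "y \<notin> Domain G" if "(y, b) \<in> T" for y b
      using that descendant_inside[OF _ x] by (auto simp: T_def)
    have "good (G \<union> T)"
      unfolding good_def
    proof (intro conjI ballI, goal_cases)
      case 1
      have "b = b'" if "(y, b) \<in> T" "(y, b') \<in> T" for y b b'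
        using that descendant_parity_unique[OF _ _ x] unfolding T_def by blast
      moreover have "(y, b') \<notin> G" if "(y, b) \<in> T" for y b b'
        using T[OF that] by blast
      ultimately show ?case using sv by (intro single_valuedI) (metis Un_iff)
    next
      case (2 z)
      \<comment> \<open>The children of \<open>y\<close> come from the chosen \<open>d y\<close>,
        but any other sequence \<open>e\<close> with limit \<open>y\<close> agrees with it almost
        everywhere.\<close>
      have new: "\<forall>\<^sub>F n in p. (e n, \<not> b) \<in> G \<union> T" if e: "discrete_limit p e y" and yb: "(y, b) \<in> T" for y b e
      proof -
        have "\<forall>\<^sub>F n in p. (d y n, \<not> b) \<in> T"
          using descendant_children[OF _ x] yb by (auto simp: T_def)
        with discrete_limit_unique[OF p(1) lim[OF T[OF yb]] e] show ?thesis
          by eventually_elim simp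
      qed
      have "\<forall>\<^sub>F n in p. (e n, \<not> b) \<in> G \<union> T" if e: "discrete_limit p e y" and yb: "(y, b) \<in> G" for y b e
        using Gd[OF yb e] by eventually_elim simp
      with new 2 show ?case by blast
    qed
    then have "G \<union> T = G" by (rule max) auto
    moreover have "(x, False) \<in> T" by (auto simp: T_def intro: descendant.root)
    ultimately show False using x by blast
  qed
  have "\<forall>\<^sub>F n in p. ((d n, True) \<in> G) \<noteq> ((q, True) \<in> G)" if d: "discrete_limit p d q" for d q
  proof -
    obtain b where b: "(q, b) \<in> G" using total by blast
    from Gd[OF b d] show ?thesis
      by eventually_elim (use b sv in \<open>metis (full_types)\<close>)
  qed
  then show ?thesis by (intro exI[of _ "\<lambda>x. (x, True) \<in> G"]) blast
qed

subsection \<open>Copies of \<open>\<omega> \<union> {p}\<close>\<close>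

lemma openin_subtopology_beta_omega_base:
  assumes "openin (subtopology beta_omega S) U" "F \<in> U"
  shows "\<exists>A. F \<in> stone_set A \<and> stone_set A \<inter> S \<subseteq> U"
proof -
  obtain W where W: "openin beta_omega W" "U = W \<inter> S"
    using assms(1) by (auto simp: openin_subtopology)
  then obtain A where "F \<in> stone_set A" "stone_set A \<subseteq> W"
    using assms(2) openin_beta_omega_base by blast
  then show ?thesis using W by blast
qed

text \<open>Send \<open>k\<close> to the least \<open>m\<close> with \<open>A m k\<close>: along
  \<open>d n\<close>, only the finitely many earlier sets have to be avoided.\<close>

lemma separated_by_if_isolated:
  assumes d: "\<And>n. ultrafilter (d n)" and A: "\<And>n. eventually (A n) (d n)"
    and sep: "\<And>m n. m \<noteq> n \<Longrightarrow> \<not> eventually (A m) (d n)"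
  shows "\<exists>f. separated_by f d"
proof -
  have "\<forall>\<^sub>F k in d n. (LEAST m. A m k) = n" for n
  proof -
    have "\<forall>\<^sub>F k in d n. \<forall>m\<in>{..<n}. \<not> A m k"
      using sep d by (intro eventually_ball_finite) (auto simp: ultrafilter_not_iff)
    with A[of n] show ?thesis
      by eventually_elim (metis Least_equality lessThan_iff not_le_imp_less)
  qed
  then show ?thesis unfolding separated_by_def by (intro exI[of _ "\<lambda>k. LEAST m. A m k"]) blast
qed

text \<open>Openness of the map carries the isolated points of \<open>omega\<close> to isolated
  points, which gives separation; continuity at \<open>p\<close> gives the limit.\<close>

lemma discrete_limit_if_homeomorphic:
  assumes p: "p \<in> topspace beta_omega" "p \<notin> omega"
    and hom: "homeomorphic_map (subtopology beta_omega (omega \<union> {p})) (subtopology beta_omega Y) \<phi>"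
  shows "discrete_limit p (\<lambda>n. \<phi> (principal {n})) (\<phi> p)"
proof -
  let ?X = "subtopology beta_omega (omega \<union> {p})" and ?Y = "subtopology beta_omega Y"
  let ?e = "\<lambda>n::nat. principal {n}"
  have omega: "omega \<subseteq> topspace beta_omega"
    by (auto simp: omega_def topspace_beta_omega ultrafilter_principal)
  have X: "topspace ?X = insert p omega" using p omega by auto
  have e: "?e n \<in> insert p omega" for n by (auto simp: omega_def)
  have img: "\<phi> ` insert p omega = topspace ?Y" and inj: "inj_on \<phi> (insert p omega)"
    using homeomorphic_imp_surjective_map[OF hom] homeomorphic_imp_injective_map[OF hom]
    by (simp_all only: X)
  have uf: "ultrafilter (\<phi> x)" if "x \<in> insert p omega" for x
    using img that by (auto simp: topspace_beta_omega)
  have inj_e: "?e m \<noteq> ?e n" if "m \<noteq> n" for m n :: nat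
    using that by (metis order_refl principal_le_iff singletonD singletonI subsetD)
  have "\<exists>A. eventually (\<lambda>k. k \<in> A) (\<phi> (?e n)) \<and> (\<forall>m. m \<noteq> n \<longrightarrow> \<not> eventually (\<lambda>k. k \<in> A) (\<phi> (?e m)))" for n
  proof -
    have "stone_set {n} \<inter> (omega \<union> {p}) = {?e n}"
    proof -
      have "x = ?e n" if "x \<in> stone_set {n}" for x
      proof (rule ccontr)
        assume "x \<noteq> ?e n"
        moreover have "ultrafilter x" "\<forall>\<^sub>F k in x. k = n" using that by (simp_all add: stone_set_def)
        ultimately show False
          using ultrafilter_nonprincipal_neq[of x n] ultrafilter_not_iff[of x "\<lambda>k. k = n"] by blast
      qed
      moreover have "?e n \<in> stone_set {n}"
        by (simp add: stone_set_def ultrafilter_principal eventually_principal)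
      moreover have "?e n \<in> omega \<union> {p}" using e[of n] by simp
      ultimately show ?thesis by blast
    qed
    then have "openin ?X {?e n}"
      unfolding openin_subtopology using openin_stone_set by blast
    then have "openin ?Y (\<phi> ` {?e n})"
      using homeomorphic_imp_open_map[OF hom] unfolding open_map_def by blast
    then obtain A where A: "\<phi> (?e n) \<in> stone_set A" "stone_set A \<inter> Y \<subseteq> {\<phi> (?e n)}"
      using openin_subtopology_beta_omega_base[of Y "\<phi> ` {?e n}" "\<phi> (?e n)"] by auto
    have "\<not> eventually (\<lambda>k. k \<in> A) (\<phi> (?e m))" if "m \<noteq> n" for m
    proof
      assume "eventually (\<lambda>k. k \<in> A) (\<phi> (?e m))"
      then have "\<phi> (?e m) \<in> stone_set A" using uf[OF e] by (simp add: stone_set_def)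
      moreover have "\<phi> (?e m) \<in> Y" using img e[of m] by auto
      ultimately have "\<phi> (?e m) = \<phi> (?e n)" using A(2) by blast
      then show False using inj e inj_e[OF that] by (meson inj_onD)
    qed
    then show ?thesis using A(1) by (auto simp: stone_set_def)
  qed
  then obtain A where A: "\<And>n. eventually (\<lambda>k. k \<in> A n) (\<phi> (?e n))"
    "\<And>n m. m \<noteq> n \<Longrightarrow> \<not> eventually (\<lambda>k. k \<in> A n) (\<phi> (?e m))"
    by metis
  have "\<exists>f. separated_by f (\<lambda>n. \<phi> (?e n))"
    by (rule separated_by_if_isolated[of _ "\<lambda>n k. k \<in> A n"]) (use A uf[OF e] in auto)
  moreover have "\<forall>\<^sub>F n in p. eventually P (\<phi> (?e n))" if P: "eventually P (\<phi> p)" for P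
  proof -
    let ?U = "{x \<in> topspace ?X. \<phi> x \<in> stone_set {k. P k} \<inter> Y}"
    have "openin ?Y (stone_set {k. P k} \<inter> Y)" using openin_stone_set openin_subtopology by blast
    then have "openin ?X ?U"
      using homeomorphic_imp_continuous_map[OF hom] openin_continuous_map_preimage by blast
    moreover have "p \<in> ?U"
    proof -
      have "\<phi> p \<in> Y" using img by auto
      then show ?thesis using P uf[of p] X by (simp add: stone_set_def)
    qed
    ultimately obtain B where B: "p \<in> stone_set B" "stone_set B \<inter> (omega \<union> {p}) \<subseteq> ?U"
      using openin_subtopology_beta_omega_base by blast
    have "eventually P (\<phi> (?e n))" if "n \<in> B" for n
    proof -
      have "?e n \<in> stone_set B"
        using that by (simp add: stone_set_def ultrafilter_principal eventually_principal)
      then have "?e n \<in> ?U" using B(2) e[of n] by auto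
      then show ?thesis by (simp add: stone_set_def)
    qed
    then show ?thesis using B(1) by (auto simp: stone_set_def elim: eventually_mono)
  qed
  ultimately show ?thesis using uf e by (auto simp: discrete_limit_def)
qed

theorem theorem5p13:
  shows "\<forall>p \<in> topspace omega_star. \<not> top_arrow omega_star (subtopology beta_omega (omega \<union> {p}))"
proof
  fix p assume "p \<in> topspace omega_star"
  then have p: "p \<in> topspace beta_omega" "p \<notin> omega" by (auto simp: omega_star_def)
  have uf: "ultrafilter p" "p \<noteq> principal {n}" for n
    using p by (auto simp: topspace_beta_omega omega_def)
  obtain c :: "nat filter \<Rightarrow> bool" where
    c: "\<And>d q. discrete_limit p d q \<Longrightarrow> \<forall>\<^sub>F n in p. c (d n) \<noteq> c q"
    using discrete_limit_two_colouring[of p] uf by metis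
  let ?P = "\<lambda>b. {x \<in> topspace omega_star. c x = b}"
  have no_copy: "\<not> subtopology omega_star Y homeomorphic_space subtopology beta_omega (omega \<union> {p})"
    if Y: "Y \<subseteq> ?P b" for Y b
  proof
    assume "subtopology omega_star Y homeomorphic_space subtopology beta_omega (omega \<union> {p})"
    moreover have "subtopology omega_star Y = subtopology beta_omega Y"
      using Y by (auto simp: omega_star_def subtopology_subtopology intro!: arg_cong[of _ _ "subtopology beta_omega"])
    ultimately obtain \<phi> where
      \<phi>: "homeomorphic_map (subtopology beta_omega (omega \<union> {p})) (subtopology beta_omega Y) \<phi>"
      by (metis homeomorphic_space homeomorphic_space_sym)
    have "\<phi> x \<in> Y" if "x \<in> insert p omega" for x
    proof -
      have "x \<in> topspace (subtopology beta_omega (omega \<union> {p}))"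
        using that p by (auto simp: topspace_beta_omega omega_def ultrafilter_principal)
      then show ?thesis using homeomorphic_imp_surjective_map[OF \<phi>] by auto
    qed
    \<comment> \<open>A one-coloured copy would give its limit point the colour of its
      sequence.\<close>
    then have "c (\<phi> p) = b" "\<And>n. c (\<phi> (principal {n})) = b"
      using Y by (auto simp: omega_def)
    then have "\<forall>\<^sub>F n in p. False"
      using c[OF discrete_limit_if_homeomorphic[OF p \<phi>]] by simp
    then show False using uf(1) by (simp add: ultrafilter_def)
  qed
  show "\<not> top_arrow omega_star (subtopology beta_omega (omega \<union> {p}))"
  proof
    assume "top_arrow omega_star (subtopology beta_omega (omega \<union> {p}))"
    moreover have "topspace omega_star = ?P True \<union> ?P False" by auto
    ultimately obtain P Y where "P \<in> {?P True, ?P False}" "Y \<subseteq> P"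
      and Y: "subtopology omega_star Y homeomorphic_space subtopology beta_omega (omega \<union> {p})"
      unfolding top_arrow_def by meson
    then have "Y \<subseteq> ?P True \<or> Y \<subseteq> ?P False" by (elim insertE) simp_all
    then show False using no_copy[of Y True] no_copy[of Y False] Y by argo
  qed
qed

end
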